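(* Let $d$ be a positive integer and suppose that $A\subseteq\mathbb{R}^d$ is a compact strip-null set. Then for every $\varepsilon>0$, there is a 1-Lipschitz map $f:\mathbb{R}^d\to\mathbb{R}^d$ such that $|f(x)-x|\le\varepsilon$ for every $x\in\mathbb{R}^d$ and $f(A)$ can be covered by finitely many hyperplanes.
   Context: $|\cdot|$ is the Euclidean norm and 1-Lipschitz is with respect to it; hyperplanes are affine. A strip of width $w>0$ in $\mathbb{R}^d$ is the closed region between two parallel hyperplanes at distance $w$. A set in $\mathbb{R}^d$ is strip-null if for every $\varepsilon>0$ it can be covered by countably many strips of total width at most $\varepsilon$. *)

theory Defs
  imports "HOL-Analysis.Analysis"
begin

definition is_hyperplane :: "'a::euclidean_space set \<Rightarrow> bool" where
  "is_hyperplane H \<longleftrightarrow> (\<exists>a b. a \<noteq> 0 \<and> H = {x. a \<bullet> x = b})"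

text \<open>Since the normal \<open>u\<close> is a unit vector, the two bounding hyperplanes
  \<open>u \<bullet> x = b\<close> and \<open>u \<bullet> x = b + w\<close> are at distance exactly \<open>w\<close>.\<close>

definition is_strip :: "real \<Rightarrow> 'a::euclidean_space set \<Rightarrow> bool" where
  "is_strip w S \<longleftrightarrow> 0 < w \<and>
     (\<exists>u b. norm u = 1 \<and> S = {x. b \<le> u \<bullet> x \<and> u \<bullet> x \<le> b + w})"

text \<open>The index set \<open>I\<close> ranges over arbitrary sets of naturals, so the countable family of
  strips may be finite or infinite. Summability must be required explicitly, because
  \<open>infsum\<close> is 0 on families that are not summable.\<close>

definition strip_null :: "'a::euclidean_space set \<Rightarrow> bool" where
  "strip_null A \<longleftrightarrow> (\<forall>\<epsilon>>0. \<exists>(I::nat set) w S.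
     (\<forall>i\<in>I. is_strip (w i) (S i)) \<and> A \<subseteq> (\<Union>i\<in>I. S i) \<and>
     w summable_on I \<and> infsum w I \<le> \<epsilon>)"

end

theory Submission
  imports Defs
begin

text \<open>By compactness, finitely many strips \<open>\<bar>u\<^sub>i \<bullet> x - c\<^sub>i\<bar> \<le> a\<^sub>i\<close> with
  \<open>\<Sum>a\<^sub>i \<le> \<epsilon>\<close> cover \<open>A\<close>. For a choice of signs \<open>\<sigma>\<close> let \<open>v\<^sub>\<sigma> = \<Sum>\<sigma>\<^sub>i a\<^sub>i u\<^sub>i\<close> and
  \<open>s\<^sub>\<sigma> = \<Sum>\<sigma>\<^sub>i a\<^sub>i c\<^sub>i - \<bar>v\<^sub>\<sigma>\<bar>\<^sup>2/2\<close>, and let \<open>f\<close> be the proximal map of the convex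
  function \<open>h y = max\<^sub>\<sigma> (v\<^sub>\<sigma> \<bullet> y - s\<^sub>\<sigma>)\<close>, that is, \<open>x - f x\<close> is a subgradient of \<open>h\<close> at \<open>f x\<close>.
  Proximal maps are 1-Lipschitz, and \<open>f\<close> moves points by at most the Lipschitz constant of \<open>h\<close>.
  If \<open>y = f x\<close> is on none of the finitely many hyperplanes on which two of the affine pieces
  with different gradients agree, then \<open>x = y + v\<^sub>\<sigma>\<close> for the maximizing \<open>\<sigma>\<close>. As in Bang's
  solution of the plank problem, comparing \<open>\<sigma>\<close> with the choice in which the single sign
  \<open>\<sigma>\<^sub>i\<close> is flipped shows that \<open>x\<close> is outside the \<open>i\<close>-th strip.\<close>

section \<open>Proximal maps of convex Lipschitz functions\<close>

text \<open>The point \<open>y\<close> is a minimizer of \<open>h z + (norm (z - x))^2 / 2\<close>,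
  and the inequality is its first-order optimality condition.\<close>

lemma proximal_point_exists:
  fixes h :: "'a::euclidean_space \<Rightarrow> real"
  assumes conv: "convex_on UNIV h" and lip: "L-lipschitz_on UNIV h"
  shows "\<exists>y. \<forall>z. h y + (x - y) \<bullet> (z - y) \<le> h z"
proof -
  have L: "0 \<le> L" using lip by (rule lipschitz_on_nonneg)
  have lip': "\<bar>h p - h q\<bar> \<le> L * norm (p - q)" for p q
    using lipschitz_onD[OF lip, of p q] by (simp add: dist_norm)
  define g where "g z = h z + (norm (z - x))\<^sup>2 / 2" for z
  \<comment> \<open>At distance \<open>r > 2 * L\<close> from \<open>x\<close> the penalty
    \<open>r^2 / 2\<close> exceeds \<open>L * r\<close>, the most that \<open>h\<close> can drop, so
    a minimizer on the ball is a global one.\<close>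
  define R where "R = 2 * L + 1"
  have "continuous_on (cball x R) g"
    unfolding g_def
    by (intro continuous_intros continuous_on_subset[OF lipschitz_on_continuous_on[OF lip]]) auto
  moreover have "cball x R \<noteq> {}" using L by (simp add: R_def)
  ultimately obtain y where y: "\<And>z. z \<in> cball x R \<Longrightarrow> g y \<le> g z"
    using continuous_attains_inf[OF compact_cball] by metis
  have min: "g y \<le> g z" for z
  proof (cases "z \<in> cball x R")
    case False
    define r where "r = norm (z - x)"
    have r: "r > 2 * L + 1" using False by (simp add: r_def R_def dist_norm norm_minus_commute)
    have "h x \<le> h z + L * r" using lip'[of x z] by (simp add: r_def norm_minus_commute)
    moreover have "L * r \<le> r\<^sup>2 / 2"
      using mult_right_mono[of "2 * L" r r] r L by (simp add: power2_eq_square)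
    ultimately have "g x \<le> g z" by (simp add: g_def r_def)
    then show ?thesis using y[of x] L by (force simp: R_def)
  qed (rule y)
  have "h y + (x - y) \<bullet> (z - y) \<le> h z" for z
  proof -
    define d where "d = z - y"
    \<comment> \<open>Compare \<open>y\<close> with \<open>y + t d\<close> on the segment to
      \<open>z\<close>: after division by \<open>t\<close> only the quadratic error remains, which
      vanishes as \<open>t\<close> tends to 0.\<close>
    have le: "h y + (x - y) \<bullet> d - h z \<le> t * (norm d)\<^sup>2 / 2" if t: "0 < t" "t < 1" for t :: real
    proof -
      have "h (y + t *\<^sub>R d) \<le> (1 - t) * h y + t * h z"
        using convex_onD[OF conv, of t y z] t by (simp add: d_def algebra_simps)
      moreover have "(norm (y + t *\<^sub>R d - x))\<^sup>2
          = (norm (y - x))\<^sup>2 - 2 * t * ((x - y) \<bullet> d) + t\<^sup>2 * (norm d)\<^sup>2"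
        by (simp only: power2_norm_eq_inner) (simp add: algebra_simps inner_commute power2_eq_square)
      ultimately have "0 \<le> t * (h z - h y - (x - y) \<bullet> d + t * (norm d)\<^sup>2 / 2)"
        using min[of "y + t *\<^sub>R d"] by (simp add: g_def algebra_simps power2_eq_square)
      then show ?thesis using t by (simp add: zero_le_mult_iff)
    qed
    have "((\<lambda>t::real. t * (norm d)\<^sup>2 / 2) \<longlongrightarrow> 0 * (norm d)\<^sup>2 / 2) (at_right 0)"
      by (intro tendsto_intros) simp
    moreover have "\<forall>\<^sub>F t in at_right (0::real). h y + (x - y) \<bullet> d - h z \<le> t * (norm d)\<^sup>2 / 2"
      unfolding eventually_at_right_field using le by (intro exI[of _ 1]) auto
    ultimately have "h y + (x - y) \<bullet> d - h z \<le> 0 * (norm d)\<^sup>2 / 2"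
      by (rule tendsto_lowerbound) simp
    then show ?thesis by (simp add: d_def)
  qed
  then show ?thesis by blast
qed

text \<open>Adding the subgradient inequalities at \<open>f x\<close> and \<open>f y\<close> cancels
  the values of \<open>h\<close> and leaves firm nonexpansiveness. The displacement bound comes from
  the inequality with \<open>z = x\<close>.\<close>

lemma proximal_map_exists:
  fixes h :: "'a::euclidean_space \<Rightarrow> real"
  assumes conv: "convex_on UNIV h" and lip: "L-lipschitz_on UNIV h"
  obtains f where "1-lipschitz_on UNIV f" "\<And>x. norm (f x - x) \<le> L"
    "\<And>x z. h (f x) + (x - f x) \<bullet> (z - f x) \<le> h z"
proof -
  obtain f where f: "h (f x) + (x - f x) \<bullet> (z - f x) \<le> h z" for x z
    using proximal_point_exists[OF assms] by metis
  have "1-lipschitz_on UNIV f"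
  proof (rule lipschitz_onI)
    fix x y
    have "(norm (f x - f y))\<^sup>2 \<le> (x - y) \<bullet> (f x - f y)"
      using f[of x "f y"] f[of y "f x"]
      by (simp add: power2_norm_eq_inner algebra_simps inner_commute)
    also have "\<dots> \<le> norm (x - y) * norm (f x - f y)" by (rule norm_cauchy_schwarz)
    finally show "dist (f x) (f y) \<le> 1 * dist x y"
      by (cases "f x = f y") (simp_all add: dist_norm power2_eq_square)
  qed simp
  moreover have "norm (f x - x) \<le> L" for x
  proof -
    have "(norm (x - f x))\<^sup>2 \<le> h x - h (f x)"
      using f[of x x] by (simp add: power2_norm_eq_inner)
    also have "\<dots> \<le> L * norm (x - f x)"
      using lipschitz_onD[OF lip, of x "f x"] by (simp add: dist_norm)
    finally show ?thesis
      using lipschitz_on_nonneg[OF lip]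
      by (cases "f x = x") (simp_all add: power2_eq_square norm_minus_commute)
  qed
  ultimately show ?thesis using f that by blast
qed

section \<open>Maxima of finitely many affine functions\<close>

lemma convex_on_Max_affine:
  fixes v :: "'j \<Rightarrow> 'a::real_inner"
  assumes "finite E" "E \<noteq> {}"
  shows "convex_on UNIV (\<lambda>y. Max ((\<lambda>j. v j \<bullet> y - s j) ` E))"
proof (rule convex_onI)
  fix t :: real and x y :: 'a
  assume t: "0 < t" "t < 1"
  let ?h = "\<lambda>y. Max ((\<lambda>j. v j \<bullet> y - s j) ` E)"
  have "v j \<bullet> ((1 - t) *\<^sub>R x + t *\<^sub>R y) - s j \<le> (1 - t) * ?h x + t * ?h y" if "j \<in> E" for j
  proof -
    have "v j \<bullet> ((1 - t) *\<^sub>R x + t *\<^sub>R y) - s j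
        = (1 - t) * (v j \<bullet> x - s j) + t * (v j \<bullet> y - s j)"
      by (simp add: algebra_simps)
    also have "\<dots> \<le> (1 - t) * ?h x + t * ?h y"
      using t that assms by (intro add_mono mult_left_mono Max_ge) auto
    finally show ?thesis .
  qed
  then show "?h ((1 - t) *\<^sub>R x + t *\<^sub>R y) \<le> (1 - t) * ?h x + t * ?h y"
    using assms by simp
qed simp

lemma lipschitz_on_Max_affine:
  fixes v :: "'j \<Rightarrow> 'a::real_inner"
  assumes "finite E" "E \<noteq> {}" and L: "\<And>j. j \<in> E \<Longrightarrow> norm (v j) \<le> L"
  shows "L-lipschitz_on UNIV (\<lambda>y. Max ((\<lambda>j. v j \<bullet> y - s j) ` E))"
proof (rule lipschitz_onI)
  let ?h = "\<lambda>y. Max ((\<lambda>j. v j \<bullet> y - s j) ` E)"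
  have le: "?h x \<le> ?h y + L * norm (x - y)" for x y
  proof -
    have "v j \<bullet> x - s j \<le> ?h y + L * norm (x - y)" if j: "j \<in> E" for j
    proof -
      have "v j \<bullet> (x - y) \<le> L * norm (x - y)"
        using norm_cauchy_schwarz[of "v j" "x - y"] mult_right_mono[OF L[OF j], of "norm (x - y)"]
        by simp
      moreover have "v j \<bullet> y - s j \<le> ?h y" using j assms by (intro Max_ge) auto
      ultimately show ?thesis by (simp add: inner_diff_right)
    qed
    then show ?thesis using assms by simp
  qed
  show "dist (?h x) (?h y) \<le> L * dist x y" for x y
    using le[of x y] le[of y x] by (simp add: dist_norm norm_minus_commute)
  show "0 \<le> L" using assms by (meson ex_in_conv norm_ge_zero order_trans)
qed

text \<open>Off the hyperplanes on which two pieces with different gradients agree, a maximum of affine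
  functions is locally affine, so that its subgradient is unique.\<close>

lemma subgradient_Max_affine:
  fixes v :: "'j \<Rightarrow> 'a::real_inner"
  assumes E: "finite E" and j: "j \<in> E"
    and less: "\<And>k. k \<in> E \<Longrightarrow> v k \<noteq> v j \<Longrightarrow> v k \<bullet> y - s k < v j \<bullet> y - s j"
    and le: "\<And>k. k \<in> E \<Longrightarrow> v k \<bullet> y - s k \<le> v j \<bullet> y - s j"
    and sub: "\<And>z. Max ((\<lambda>j. v j \<bullet> y - s j) ` E) + p \<bullet> (z - y) \<le> Max ((\<lambda>j. v j \<bullet> z - s j) ` E)"
  shows "p = v j"
proof -
  \<comment> \<open>Along this direction piece \<open>j\<close> stays maximal for small
    \<open>t > 0\<close>, so the subgradient inequality forces
    \<open>t * (d \<bullet> d) \<le> 0\<close>.\<close>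
  define d where "d = p - v j"
  have ev: "\<forall>\<^sub>F t in at_right (0::real). v k \<bullet> (y + t *\<^sub>R d) - s k \<le> v j \<bullet> (y + t *\<^sub>R d) - s j"
    if k: "k \<in> E" for k
  proof (cases "v k = v j")
    case True
    then show ?thesis using le[OF k] by simp
  next
    case False
    have "((\<lambda>t. (v j \<bullet> (y + t *\<^sub>R d) - s j) - (v k \<bullet> (y + t *\<^sub>R d) - s k)) \<longlongrightarrow>
        (v j \<bullet> (y + 0 *\<^sub>R d) - s j) - (v k \<bullet> (y + 0 *\<^sub>R d) - s k)) (at_right (0::real))"
      by (intro tendsto_intros)
    from order_tendstoD(1)[OF this, of 0] less[OF k False] show ?thesis
      by (auto elim!: eventually_mono)
  qed
  have "\<forall>\<^sub>F t in at_right (0::real).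
      t > 0 \<and> (\<forall>k\<in>E. v k \<bullet> (y + t *\<^sub>R d) - s k \<le> v j \<bullet> (y + t *\<^sub>R d) - s j)"
    using ev E
    by (intro eventually_conj eventually_ball_finite ballI eventually_at_right_less)
  then obtain t :: real where t: "t > 0"
      "\<And>k. k \<in> E \<Longrightarrow> v k \<bullet> (y + t *\<^sub>R d) - s k \<le> v j \<bullet> (y + t *\<^sub>R d) - s j"
    using eventually_happens'[OF trivial_limit_at_right_real] by blast
  have "Max ((\<lambda>j. v j \<bullet> (y + t *\<^sub>R d) - s j) ` E) \<le> v j \<bullet> (y + t *\<^sub>R d) - s j"
    using t(2) E j by (subst Max_le_iff) auto
  moreover have "v j \<bullet> y - s j \<le> Max ((\<lambda>j. v j \<bullet> y - s j) ` E)"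
    using E j by (intro Max_ge) auto
  ultimately have "t * (d \<bullet> d) \<le> 0"
    using sub[of "y + t *\<^sub>R d"] by (simp add: d_def algebra_simps)
  then have "d = 0"
    using t(1) by (metis inner_gt_zero_iff mult_pos_pos not_less)
  then show ?thesis by (simp add: d_def)
qed

section \<open>Collapsing finitely many strips\<close>

lemma finite_strips_collapse:
  fixes u :: "'i \<Rightarrow> 'a::euclidean_space" and a c :: "'i \<Rightarrow> real"
  assumes F: "finite F" and u: "\<And>i. i \<in> F \<Longrightarrow> norm (u i) = 1" and a: "\<And>i. i \<in> F \<Longrightarrow> 0 < a i"
  obtains f :: "'a \<Rightarrow> 'a" and \<H> where
    "1-lipschitz_on UNIV f" "\<And>x. norm (f x - x) \<le> sum a F"
    "finite \<H>" "\<And>H. H \<in> \<H> \<Longrightarrow> is_hyperplane H"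
    "\<And>i x. i \<in> F \<Longrightarrow> \<bar>u i \<bullet> x - c i\<bar> \<le> a i \<Longrightarrow> f x \<in> \<Union>\<H>"
proof -
  \<comment> \<open>A choice of signs is encoded by the set \<open>J \<subseteq> F\<close> of indices with positive sign.\<close>
  define \<sigma> :: "'i set \<Rightarrow> 'i \<Rightarrow> real" where "\<sigma> J i = (if i \<in> J then 1 else -1)" for J i
  define v where "v J = (\<Sum>i\<in>F. (\<sigma> J i * a i) *\<^sub>R u i)" for J
  \<comment> \<open>With this shift, \<open>v J \<bullet> y - s J\<close> equals
    \<open>((norm (y + v J))^2 - (norm y)^2) / 2\<close> minus the sum of
    \<open>\<sigma> J i * a i * c i\<close>, so a maximizing \<open>J\<close> maximizes Bang's
    functional at \<open>y + v J\<close>.\<close>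
  define s where "s J = (\<Sum>i\<in>F. \<sigma> J i * a i * c i) - (norm (v J))\<^sup>2 / 2" for J
  define h where "h y = Max ((\<lambda>J. v J \<bullet> y - s J) ` Pow F)" for y
  \<comment> \<open>Pairs with \<open>v J = v K\<close> are left out, as their equation defines the
    empty set or the whole space.\<close>
  define \<H> where "\<H> = (\<lambda>(J, K). {y. (v J - v K) \<bullet> y = s J - s K}) `
      {(J, K) \<in> Pow F \<times> Pow F. v J \<noteq> v K}"
  have fin: "finite (Pow F)" "Pow F \<noteq> {}" using F by auto
  have "norm (v J) \<le> sum a F" for J
  proof -
    have "norm (v J) \<le> (\<Sum>i\<in>F. norm ((\<sigma> J i * a i) *\<^sub>R u i))" unfolding v_def by (rule norm_sum)
    also have "\<dots> = sum a F"
      by (rule sum.cong) (use u a in \<open>auto simp: \<sigma>_def less_imp_le\<close>)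
    finally show ?thesis .
  qed
  then have lip: "(sum a F)-lipschitz_on UNIV h"
    unfolding h_def using fin by (intro lipschitz_on_Max_affine) auto
  have conv: "convex_on UNIV h"
    unfolding h_def using fin by (intro convex_on_Max_affine)
  obtain f where f: "1-lipschitz_on UNIV f" "\<And>x. norm (f x - x) \<le> sum a F"
      "\<And>x z. h (f x) + (x - f x) \<bullet> (z - f x) \<le> h z"
    using proximal_map_exists[OF conv lip] by blast
  have "finite \<H>"
    unfolding \<H>_def
    by (intro finite_imageI finite_subset[OF _ finite_cartesian_product[OF fin(1) fin(1)]]) auto
  moreover have "is_hyperplane H" if H: "H \<in> \<H>" for H
  proof -
    obtain J K where "v J - v K \<noteq> 0" "H = {y. (v J - v K) \<bullet> y = s J - s K}"
      using H unfolding \<H>_def by auto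
    then show ?thesis unfolding is_hyperplane_def by blast
  qed
  moreover have "f x \<in> \<Union>\<H>" if i: "i \<in> F" and x: "\<bar>u i \<bullet> x - c i\<bar> \<le> a i" for i x
  proof (rule ccontr)
    assume notin: "f x \<notin> \<Union>\<H>"
    let ?y = "f x"
    have "h ?y \<in> (\<lambda>J. v J \<bullet> ?y - s J) ` Pow F" unfolding h_def using fin by (intro Max_in) auto
    then obtain J where J: "J \<in> Pow F" "h ?y = v J \<bullet> ?y - s J" by auto
    have le: "v K \<bullet> ?y - s K \<le> v J \<bullet> ?y - s J" if "K \<in> Pow F" for K
      unfolding J(2)[symmetric] h_def using fin that by (intro Max_ge) auto
    have less: "v K \<bullet> ?y - s K < v J \<bullet> ?y - s J" if "K \<in> Pow F" "v K \<noteq> v J" for K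
    proof -
      have "?y \<notin> {y. (v K - v J) \<bullet> y = s K - s J}"
        using notin that J(1) unfolding \<H>_def by blast
      then have "v K \<bullet> ?y - s K \<noteq> v J \<bullet> ?y - s J" by (auto simp: inner_diff_left)
      with le[OF that(1)] show ?thesis by simp
    qed
    have xy: "x - ?y = v J"
      using fin(1) J(1) less le
    proof (rule subgradient_Max_affine)
      show "Max ((\<lambda>J. v J \<bullet> ?y - s J) ` Pow F) + (x - ?y) \<bullet> (z - ?y)
          \<le> Max ((\<lambda>J. v J \<bullet> z - s J) ` Pow F)" for z
        using f(3)[of x z] by (simp only: h_def)
    qed
    define K where "K = (if i \<in> J then J - {i} else insert i J)"
    have K: "K \<in> Pow F" using J(1) i by (auto simp: K_def)
    have flip: "\<sigma> K k = \<sigma> J k - (if k = i then 2 * \<sigma> J i else 0)" for k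
      by (auto simp: \<sigma>_def K_def)
    have "v K = (\<Sum>k\<in>F. (\<sigma> J k * a k) *\<^sub>R u k - (if k = i then (2 * \<sigma> J i * a i) *\<^sub>R u i else 0))"
      unfolding v_def by (rule sum.cong) (auto simp: flip algebra_simps)
    also have "\<dots> = v J - (2 * \<sigma> J i * a i) *\<^sub>R u i"
      using F i by (simp add: sum_subtractf v_def)
    finally have vK: "v K = v J - (2 * \<sigma> J i * a i) *\<^sub>R u i" .
    have "(\<Sum>k\<in>F. \<sigma> K k * a k * c k)
        = (\<Sum>k\<in>F. \<sigma> J k * a k * c k - (if k = i then 2 * \<sigma> J i * a i * c i else 0))"
      by (rule sum.cong) (auto simp: flip algebra_simps)
    also have "\<dots> = (\<Sum>k\<in>F. \<sigma> J k * a k * c k) - 2 * \<sigma> J i * a i * c i"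
      using F i by (simp add: sum_subtractf)
    finally have cK: "(\<Sum>k\<in>F. \<sigma> K k * a k * c k)
        = (\<Sum>k\<in>F. \<sigma> J k * a k * c k) - 2 * \<sigma> J i * a i * c i" .
    have \<sigma>: "\<sigma> J i * \<sigma> J i = 1" "\<bar>\<sigma> J i\<bar> = 1" by (auto simp: \<sigma>_def)
    have uu: "u i \<bullet> u i = 1" using u[OF i] by (simp add: norm_eq_1)
    have "u i \<noteq> 0" using u[OF i] by auto
    moreover have "\<sigma> J i \<noteq> 0" by (simp add: \<sigma>_def)
    ultimately have "v K \<noteq> v J" using a[OF i] by (auto simp: vK)
    from less[OF K this]
    have "s J - s K < 2 * \<sigma> J i * a i * (u i \<bullet> ?y)"
      by (simp add: vK inner_diff_left)
    \<comment> \<open>The last term, halved in \<open>s K\<close>, supplies the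
      \<open>2 * (a i)^2\<close> that becomes the margin \<open>a i\<close> after division by
      \<open>2 * a i\<close>.\<close>
    moreover have "(norm (v K))\<^sup>2
        = (norm (v J))\<^sup>2 - 4 * \<sigma> J i * a i * (u i \<bullet> v J) + 4 * (\<sigma> J i * \<sigma> J i) * (a i)\<^sup>2 * (u i \<bullet> u i)"
      unfolding vK
      by (simp only: power2_norm_eq_inner) (simp add: algebra_simps inner_commute power2_eq_square)
    ultimately have "2 * \<sigma> J i * a i * c i - 2 * \<sigma> J i * a i * (u i \<bullet> v J) + 2 * (a i)\<^sup>2
        < 2 * \<sigma> J i * a i * (u i \<bullet> ?y)"
      unfolding s_def cK \<sigma>(1) uu by argo
    then have "2 * a i * a i < 2 * a i * (\<sigma> J i * (u i \<bullet> (?y + v J) - c i))"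
      by (simp add: algebra_simps power2_eq_square)
    then have "a i < \<sigma> J i * (u i \<bullet> (?y + v J) - c i)"
      using a[OF i] by (simp only: mult_less_cancel_left)
    also have "?y + v J = x" using xy by (simp add: algebra_simps)
    also have "\<sigma> J i * (u i \<bullet> x - c i) \<le> \<bar>u i \<bullet> x - c i\<bar>"
      using \<sigma>(2) by (metis abs_ge_self abs_mult mult_1)
    finally show False using x by simp
  qed
  ultimately show ?thesis using f that by blast
qed

theorem corollary1p11:
  fixes A :: "(real ^ 'd) set" and \<epsilon> :: real
  assumes "compact A" and "strip_null A" and "\<epsilon> > 0"
  shows "\<exists>f :: real ^ 'd \<Rightarrow> real ^ 'd.
    1-lipschitz_on UNIV f \<and>
    (\<forall>x. norm (f x - x) \<le> \<epsilon>) \<and>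
    (\<exists>\<H>. finite \<H> \<and> (\<forall>H\<in>\<H>. is_hyperplane H) \<and> f ` A \<subseteq> \<Union>\<H>)"
proof -
  obtain I :: "nat set" and w S where S: "\<And>i. i \<in> I \<Longrightarrow> is_strip (w i) (S i)" "A \<subseteq> (\<Union>i\<in>I. S i)"
    and w: "w summable_on I" "infsum w I \<le> \<epsilon>"
    using assms(2,3) unfolding strip_null_def by metis
  have pos: "0 < w i" if "i \<in> I" for i using S(1)[OF that] by (simp add: is_strip_def)
  have "\<forall>i\<in>I. \<exists>u b. norm u = 1 \<and> S i = {x. b \<le> u \<bullet> x \<and> u \<bullet> x \<le> b + w i}"
    using S(1) unfolding is_strip_def by blast
  then obtain u b where u: "\<And>i. i \<in> I \<Longrightarrow> norm (u i) = 1"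
    and Seq: "\<And>i. i \<in> I \<Longrightarrow> S i = {x. b i \<le> u i \<bullet> x \<and> u i \<bullet> x \<le> b i + w i}"
    by metis
  \<comment> \<open>The concentric open strips of twice the width allow the passage to a finite subcover.\<close>
  define c where "c i = b i + w i / 2" for i
  define U where "U i = {x. \<bar>u i \<bullet> x - c i\<bar> < w i}" for i
  have opn: "open (U i)" for i unfolding U_def by (intro open_Collect_less continuous_intros)
  have "S i \<subseteq> U i" if "i \<in> I" for i
    using pos[OF that] unfolding Seq[OF that] U_def c_def by (auto simp: abs_less_iff)
  then have "(\<Union>i\<in>I. S i) \<subseteq> (\<Union>i\<in>I. U i)" by (rule UN_mono[OF order_refl])
  with S(2) have "A \<subseteq> (\<Union>i\<in>I. U i)" by (rule order_trans)
  from compactE_image[OF assms(1) opn this]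
  obtain F where F: "F \<subseteq> I" "finite F" "A \<subseteq> (\<Union>i\<in>F. U i)" .
  have "sum w F \<le> infsum w I"
    using F pos w(1) by (intro finite_sum_le_infsum) (auto simp: less_imp_le)
  then have sum: "sum w F \<le> \<epsilon>" using w(2) by simp
  have "\<And>i. i \<in> F \<Longrightarrow> norm (u i) = 1" "\<And>i. i \<in> F \<Longrightarrow> 0 < w i"
    using u pos F(1) by auto
  \<comment> \<open>The doubled strips have half-width \<open>w i\<close>, so the displacement bound
    is the sum of the original widths.\<close>
  from finite_strips_collapse[where u = u and a = w and c = c, OF F(2) this]
  obtain f \<H> where f: "1-lipschitz_on UNIV f" "\<And>x. norm (f x - x) \<le> sum w F"
      "finite \<H>" "\<And>H. H \<in> \<H> \<Longrightarrow> is_hyperplane H"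
      "\<And>i x. i \<in> F \<Longrightarrow> \<bar>u i \<bullet> x - c i\<bar> \<le> w i \<Longrightarrow> f x \<in> \<Union>\<H>" by blast
  have "f ` A \<subseteq> \<Union>\<H>"
  proof (rule image_subsetI)
    fix x assume "x \<in> A"
    then obtain i where "i \<in> F" "\<bar>u i \<bullet> x - c i\<bar> < w i" using F(3) by (auto simp: U_def)
    then show "f x \<in> \<Union>\<H>" using f(5)[of i x] by simp
  qed
  then show ?thesis using f sum by (meson order_trans)
qed

end
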